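(* Let $f\in\mathcal{B}$ with $f(0)=0$ and power series $f(z)=\sum_{n=1}^{\infty} a_n z^n$ in $\mathbb{D}$. Then the following hold. (a) $$\sum_{n=1}^{\infty}|a_n|r^n+\left(\frac{1}{1+|a_1|}+\frac{r}{1-r}\right)\sum_{n=2}^{\infty}|a_n|^2r^{2n-1}\leq 1\quad\text{for all } 0\le r\leq\frac35.$$ The number $3/5$ is sharp: for each $R\in(3/5,1)$ there exist $f\in\mathcal{B}$ with $f(0)=0$ and $r\in[0,R]$ for which this inequality fails. (b) $$\sum_{n=1}^{\infty}|a_n|r^n+\left(\frac{r^{-1}}{1+|a_1|}+\frac{1}{1-r}\right)\|f\|_r^2\leq 1\quad\text{for all } 0<r\leq\frac{5-\sqrt{17}}{2}.$$ The number $\frac{5-\sqrt{17}}{2}$ is sharp: for each $R\in\left(\frac{5-\sqrt{17}}{2},1\right)$ there exist $f\in\mathcal{B}$ with $f(0)=0$ and $r\in(0,R]$ for which this inequality fails. (c) With $a=|a_1|$, $$\sum_{n=1}^{\infty}|a_n|r^n+\left(\frac{r^{-1}}{1+|a_1|}+\frac{1}{1-r}\right)\|f\|_r^2\leq 1\quad\text{for all } 0<r\leq r(a),$$ where $$r(a)=\frac{2(1+a)}{1+2a+2a^2+\sqrt{4a^4+8a+5}}.$$ The radius $r(a)$ is sharp for any $a\in[0,1)$: for each $a\in[0,1)$ and each $R\in(r(a),1)$ there exist $f\in\mathcal{B}$ with $f(0)=0$ and $|a_1|=a$, and $r\in(0,R]$, for which this inequality fails.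
   Context: $\mathbb{D}=\{z\in\mathbb{C}: |z|<1\}$ is the open unit disk, and $\mathcal{B}$ is the class of all analytic functions $f$ in $\mathbb{D}$ with $|f(z)|\leq 1$ for all $z\in\mathbb{D}$. For $f(z)=\sum_{n=1}^{\infty}a_nz^n$ analytic in $\mathbb{D}$ and $r\in[0,1)$, the notation $\|f\|_r^2$ means $\|f\|_r^2=\sum_{n=1}^{\infty}|a_n|^2r^{2n}$. *)

theory Defs
  imports "HOL-Complex_Analysis.Complex_Analysis"
begin

abbreviation unit_disk :: "complex set" (\<open>\<bbbD>\<close>) where
  "\<bbbD> \<equiv> ball 0 1"

definition bounded_class :: "(complex \<Rightarrow> complex) set" (\<open>\<B>\<close>) where
  "\<B> = {f. f analytic_on \<bbbD> \<and> (\<forall>z\<in>\<bbbD>. norm (f z) \<le> 1)}"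

text \<open>Sums over \<open>n \<ge> 1\<close> (or \<open>n \<ge> 2\<close>) are reindexed to start at \<open>0\<close>, so the entry \<open>a 0\<close> of a
  coefficient sequence is never used.\<close>

definition has_coeffs :: "(complex \<Rightarrow> complex) \<Rightarrow> (nat \<Rightarrow> complex) \<Rightarrow> bool" where
  "has_coeffs f a \<longleftrightarrow> (\<forall>z\<in>\<bbbD>. (\<lambda>n. a (Suc n) * z ^ Suc n) sums f z)"

text \<open>\<open>\<parallel>f\<parallel>\<^sub>r\<^sup>2\<close>, as a function of the coefficients of \<open>f\<close>\<close>

definition sq_norm :: "(nat \<Rightarrow> complex) \<Rightarrow> real \<Rightarrow> real" where
  "sq_norm a r = (\<Sum>n. (norm (a (Suc n)))\<^sup>2 * r ^ (2 * Suc n))"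

definition majorant :: "(nat \<Rightarrow> complex) \<Rightarrow> real \<Rightarrow> real" where
  "majorant a r = (\<Sum>n. norm (a (Suc n)) * r ^ Suc n)"

definition bohr_sum_tail :: "(nat \<Rightarrow> complex) \<Rightarrow> real \<Rightarrow> real" where
  "bohr_sum_tail a r =
     majorant a r + (1 / (1 + norm (a 1)) + r / (1 - r)) *
       (\<Sum>n. (norm (a (n + 2)))\<^sup>2 * r ^ (2 * (n + 2) - 1))"

definition bohr_sum_norm :: "(nat \<Rightarrow> complex) \<Rightarrow> real \<Rightarrow> real" where
  "bohr_sum_norm a r =
     majorant a r + (inverse r / (1 + norm (a 1)) + 1 / (1 - r)) * sq_norm a r"

definition radius :: "real \<Rightarrow> real" where
  "radius \<alpha> = 2 * (1 + \<alpha>) / (1 + 2 * \<alpha> + 2 * \<alpha>\<^sup>2 + sqrt (4 * \<alpha> ^ 4 + 8 * \<alpha> + 5))"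

end

theory Submission
  imports Defs
begin

text \<open>Write \<open>f z = z * g z\<close> and let \<open>b\<^sub>n = a\<^sub>n\<^sub>+\<^sub>1\<close> be the coefficients of \<open>g\<close>. Multiplication by \<open>f\<close> is a
  contraction of the Hardy space, so convolution with \<open>b\<close> contracts finite sections in \<open>\<ell>\<^sup>2\<close>. Applied
  to suitable polynomials this gives Carlson's inequalities
  \<open>\<bar>b\<^sub>2\<^sub>n\<^sub>+\<^sub>1\<bar> \<le> 1 - (\<bar>b\<^sub>0\<bar>\<^sup>2 + \<dots> + \<bar>b\<^sub>n\<bar>\<^sup>2)\<close> and
  \<open>\<bar>b\<^sub>2\<^sub>n\<bar> \<le> 1 - (\<bar>b\<^sub>0\<bar>\<^sup>2 + \<dots> + \<bar>b\<^sub>n\<^sub>-\<^sub>1\<bar>\<^sup>2) - \<bar>b\<^sub>n\<bar>\<^sup>2 / (1 + \<bar>b\<^sub>0\<bar>)\<close>, whose weighted sum bounds both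
  Bohr sums by explicit functions of \<open>\<bar>a\<^sub>1\<bar>\<close> and \<open>r\<close>. The functions \<open>z (\<alpha> - z) / (1 - \<alpha> z)\<close> attain
  these bounds for \<open>0 \<le> \<alpha> \<le> 1\<close>, so everything reduces to one-variable inequalities; the extremal
  parameters are \<open>\<alpha> = 1/3\<close> in (a) and \<open>\<alpha> = 1\<close> in (b).\<close>

section \<open>Multiplication by a bounded function contracts coefficients\<close>

text \<open>Cauchy's formula for the k-th derivative on the circle of radius \<rho>. There the
  conjugate of z is \<open>\<rho>\<^sup>2 / z\<close>, so division by \<open>z ^ k\<close> turns
  into an inner product with the monomial \<open>z ^ k\<close>.\<close>

lemma power_series_coeff_has_integral:
  fixes h :: "complex \<Rightarrow> complex" and c :: "nat \<Rightarrow> complex"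
  assumes h: "\<And>z. z \<in> \<bbbD> \<Longrightarrow> (\<lambda>n. c n * z ^ n) sums h z"
    and \<rho>: "0 < \<rho>" "\<rho> < 1"
  shows "((\<lambda>t. h (circlepath 0 \<rho> t) * cnj (circlepath 0 \<rho> t) ^ k) has_integral
           (c k * \<rho> ^ (2 * k))) {0..1}"
proof -
  have holo: "h holomorphic_on \<bbbD>"
    by (rule power_series_holomorphic[where a = c]) (use h in auto)
  have "h has_fps_expansion Abs_fps c"
    unfolding has_fps_expansion_def
  proof (intro conjI)
    have "summable (\<lambda>n. c n * (1/2) ^ n)"
      using h[of "1/2"] by (simp add: sums_iff)
    then have "ereal (norm (1/2 :: complex)) \<le> fps_conv_radius (Abs_fps c)"
      unfolding fps_conv_radius_def by (intro conv_radius_geI) simp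
    then show "0 < fps_conv_radius (Abs_fps c)"
      by (rule order.strict_trans2[rotated]) simp
    have "eventually (\<lambda>z. z \<in> \<bbbD>) (nhds (0::complex))"
      by (intro eventually_nhds_in_open) auto
    then show "eventually (\<lambda>z. eval_fps (Abs_fps c) z = h z) (nhds 0)"
      by eventually_elim (use h in \<open>auto simp: eval_fps_def sums_iff\<close>)
  qed
  from fps_nth_fps_expansion[OF this, of k] have ck: "(deriv ^^ k) h 0 / fact k = c k"
    by simp
  have sub: "cball 0 \<rho> \<subseteq> \<bbbD>"
    using \<rho> by auto
  have "((\<lambda>u. h u / (u - 0) ^ Suc k) has_contour_integral
          (2 * pi * \<i>) / fact k * (deriv ^^ k) h 0) (circlepath 0 \<rho>)"
    by (rule Cauchy_has_contour_integral_higher_derivative_circlepath)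
       (use sub \<rho> holo in \<open>auto intro!: holomorphic_on_imp_continuous_on elim: holomorphic_on_subset\<close>)
  then have "((\<lambda>t. h (circlepath 0 \<rho> t) / (circlepath 0 \<rho> t) ^ Suc k *
                vector_derivative (circlepath 0 \<rho>) (at t within {0..1})) has_integral
              (2 * pi * \<i>) * c k) {0..1}"
    unfolding has_contour_integral_def ck[symmetric] by simp
  \<comment> \<open>The factor cancels the \<open>2 * pi * \<i>\<close> and supplies the
    \<open>\<rho> ^ (2 * k)\<close> that turns \<open>1 / z ^ k\<close> into
    \<open>cnj z ^ k\<close>; the derivative of the path absorbs the remaining power of z.\<close>
  then have "((\<lambda>t. h (circlepath 0 \<rho> t) / (circlepath 0 \<rho> t) ^ Suc k *
                vector_derivative (circlepath 0 \<rho>) (at t within {0..1}) * (\<rho> ^ (2 * k) / (2 * pi * \<i>)))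
              has_integral (2 * pi * \<i>) * c k * (\<rho> ^ (2 * k) / (2 * pi * \<i>))) {0..1}"
    by (rule has_integral_mult_left)
  then show ?thesis
  proof (rule has_integral_eq_rhs[OF has_integral_eq, rotated])
    fix t :: real assume t: "t \<in> {0..1}"
    define e where "e = exp (2 * of_real pi * \<i> * of_real t)"
    have e: "norm e = 1"
      by (simp add: e_def)
    then have [simp]: "e \<noteq> 0" by auto
    have ee: "e * cnj e = 1"
      using e by (simp add: complex_norm_square[symmetric])
    have cp: "circlepath 0 \<rho> t = \<rho> * e"
      by (simp add: circlepath e_def)
    have "cnj (\<rho> * e) = \<rho>\<^sup>2 / (\<rho> * e)"
      using \<rho> ee by (simp add: field_simps power2_eq_square)
    then have cnj: "cnj (\<rho> * e) ^ k = \<rho> ^ (2 * k) / (\<rho> * e) ^ k"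
      by (simp add: power_divide power_mult)
    show "h (circlepath 0 \<rho> t) / (circlepath 0 \<rho> t) ^ Suc k *
            vector_derivative (circlepath 0 \<rho>) (at t within {0..1}) * (\<rho> ^ (2 * k) / (2 * pi * \<i>)) =
          h (circlepath 0 \<rho> t) * cnj (circlepath 0 \<rho> t) ^ k"
      unfolding cp cnj using t \<rho>
      by (simp add: vector_derivative_circlepath01 e_def[symmetric] del: complex_cnj_mult)
  qed simp
qed

lemma polynomial_circle_pairing:
  fixes h :: "complex \<Rightarrow> complex" and c p :: "nat \<Rightarrow> complex"
  assumes h: "\<And>z. z \<in> \<bbbD> \<Longrightarrow> (\<lambda>n. c n * z ^ n) sums h z"
    and \<rho>: "0 < \<rho>" "\<rho> < 1"
  shows "((\<lambda>t. h (circlepath 0 \<rho> t) * cnj (\<Sum>k\<le>N. p k * circlepath 0 \<rho> t ^ k)) has_integral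
           (\<Sum>k\<le>N. c k * cnj (p k) * \<rho> ^ (2 * k))) {0..1}"
proof -
  have "((\<lambda>t. \<Sum>k\<le>N. cnj (p k) * (h (circlepath 0 \<rho> t) * cnj (circlepath 0 \<rho> t) ^ k)) has_integral
           (\<Sum>k\<le>N. cnj (p k) * (c k * \<rho> ^ (2 * k)))) {0..1}"
    by (intro has_integral_sum has_integral_mult_right power_series_coeff_has_integral[OF h \<rho>]) auto
  then show ?thesis
    by (simp add: cnj_sum sum_distrib_left algebra_simps)
qed

lemma polynomial_sums:
  fixes p :: "nat \<Rightarrow> 'a :: real_normed_algebra_1"
  assumes "\<And>k. k > N \<Longrightarrow> p k = 0"
  shows "(\<lambda>k. p k * z ^ k) sums (\<Sum>k\<le>N. p k * z ^ k)"
  by (rule sums_finite) (use assms in \<open>auto simp: not_le\<close>)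

text \<open>Bessel's inequality on circles. With P the given polynomial and Q the truncation of h,
  expanding \<open>0 \<le> \<bar>h - Q\<bar>\<^sup>2\<close> gives \<open>2 Re (h cnj Q) -
  \<bar>Q\<bar>\<^sup>2 \<le> \<bar>h\<bar>\<^sup>2 \<le> \<bar>P\<bar>\<^sup>2\<close>; integrating
  the outer terms involves only pairings with polynomials.\<close>

lemma bessel_polynomial_bound:
  fixes h :: "complex \<Rightarrow> complex" and c p :: "nat \<Rightarrow> complex"
  assumes h: "\<And>z. z \<in> \<bbbD> \<Longrightarrow> (\<lambda>n. c n * z ^ n) sums h z"
    and le: "\<And>z. z \<in> \<bbbD> \<Longrightarrow> norm (h z) \<le> norm (\<Sum>k\<le>N. p k * z ^ k)"
  shows "(\<Sum>k\<le>N. (norm (c k))\<^sup>2) \<le> (\<Sum>k\<le>N. (norm (p k))\<^sup>2)"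
proof -
  have circ: "(\<Sum>k\<le>N. (norm (c k))\<^sup>2 * \<rho> ^ (2 * k)) \<le> (\<Sum>k\<le>N. (norm (p k))\<^sup>2 * \<rho> ^ (2 * k))"
    if \<rho>: "0 < \<rho>" "\<rho> < 1" for \<rho> :: real
  proof -
    define x where "x = circlepath 0 \<rho>"
    define P where "P = (\<lambda>t. \<Sum>k\<le>N. p k * x t ^ k)"
    define Q where "Q = (\<lambda>t. \<Sum>k\<le>N. c k * x t ^ k)"
    have pair: "((\<lambda>t. Re ((\<Sum>k\<le>N. q k * x t ^ k) * cnj (\<Sum>k\<le>N. q k * x t ^ k))) has_integral
                   (\<Sum>k\<le>N. (norm (q k))\<^sup>2 * \<rho> ^ (2 * k))) {0..1}" for q :: "nat \<Rightarrow> complex"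
    proof -
      define q' where "q' = (\<lambda>k. if k \<le> N then q k else 0)"
      have "(\<lambda>k. q' k * z ^ k) sums (\<Sum>k\<le>N. q k * z ^ k)" for z
        using polynomial_sums[of N q' z] by (simp add: q'_def)
      from has_integral_Re[OF polynomial_circle_pairing[OF this \<rho>, where N = N and p = q]] show ?thesis
        unfolding x_def
        by (rule has_integral_eq_rhs)
           (auto simp: q'_def complex_norm_square[symmetric] simp flip: of_real_power intro!: sum.cong)
    qed
    have hQ: "((\<lambda>t. Re (h (x t) * cnj (Q t))) has_integral
                 (\<Sum>k\<le>N. (norm (c k))\<^sup>2 * \<rho> ^ (2 * k))) {0..1}"
      unfolding x_def Q_def
      by (rule has_integral_eq_rhs[OF has_integral_Re[OF polynomial_circle_pairing[OF h \<rho>, where N = N and p = c]]])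
         (auto simp: complex_norm_square[symmetric] simp flip: of_real_power intro!: sum.cong)
    have lhs: "((\<lambda>t. 2 * Re (h (x t) * cnj (Q t)) - Re (Q t * cnj (Q t))) has_integral
        (2 * (\<Sum>k\<le>N. (norm (c k))\<^sup>2 * \<rho> ^ (2 * k)) - (\<Sum>k\<le>N. (norm (c k))\<^sup>2 * \<rho> ^ (2 * k)))) {0..1}"
      using pair[of c] hQ unfolding Q_def
      by (intro has_integral_diff has_integral_mult_right) auto
    have rhs: "((\<lambda>t. Re (P t * cnj (P t))) has_integral (\<Sum>k\<le>N. (norm (p k))\<^sup>2 * \<rho> ^ (2 * k))) {0..1}"
      using pair[of p] unfolding P_def .
    have "2 * Re (h (x t) * cnj (Q t)) - Re (Q t * cnj (Q t)) \<le> Re (P t * cnj (P t))" for t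
    proof -
      have "x t \<in> \<bbbD>"
        using \<rho> by (simp add: x_def circlepath norm_mult)
      then have "(norm (h (x t)))\<^sup>2 \<le> (norm (P t))\<^sup>2"
        unfolding P_def using le by (intro power_mono) auto
      moreover have "0 \<le> (norm (h (x t) - Q t))\<^sup>2"
        by simp
      ultimately show ?thesis
        unfolding cmod_power2 by (simp add: power2_eq_square algebra_simps)
    qed
    from has_integral_le[OF lhs rhs this] show ?thesis
      by simp
  qed
  \<comment> \<open>Both sides are polynomials in \<rho>, so the inequality survives the limit
    \<rho> to 1.\<close>
  have lim: "((\<lambda>\<rho>::real. \<Sum>k\<le>N. (norm (q k))\<^sup>2 * \<rho> ^ (2 * k)) \<longlongrightarrow> (\<Sum>k\<le>N. (norm (q k))\<^sup>2 * 1 ^ (2 * k)))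
              (at_left 1)" for q :: "nat \<Rightarrow> complex"
    by (intro tendsto_intros)
  have "eventually (\<lambda>\<rho>::real. \<rho> \<in> {0<..<1}) (at_left 1)"
    by (rule eventually_at_left_real) simp
  then have "eventually (\<lambda>\<rho>::real. (\<Sum>k\<le>N. (norm (c k))\<^sup>2 * \<rho> ^ (2 * k)) \<le>
                             (\<Sum>k\<le>N. (norm (p k))\<^sup>2 * \<rho> ^ (2 * k))) (at_left 1)"
    by eventually_elim (use circ in auto)
  from tendsto_le[OF _ lim lim this] show ?thesis
    by simp
qed

text \<open>The product of f with a polynomial is dominated by that polynomial on the disk, and its
  coefficients are convolutions, so the Bessel bound applies.\<close>

lemma bounded_class_convolution_contractive:
  fixes p :: "nat \<Rightarrow> complex"
  assumes f: "f \<in> \<B>" and a: "has_coeffs f a"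
  shows "(\<Sum>k\<le>N. (norm (\<Sum>i\<le>k. a (Suc i) * p (k - i)))\<^sup>2) \<le> (\<Sum>k\<le>N. (norm (p k))\<^sup>2)"
proof -
  \<comment> \<open>\<open>has_coeffs\<close> leaves \<open>a 0\<close> free, so it is reset to 0; p
    is cut off beyond N to become a polynomial.\<close>
  define a0 where "a0 = a(0 := 0)"
  define q where "q = (\<lambda>k. if k \<le> N then p k else 0)"
  define c where "c = (\<lambda>k. \<Sum>i\<le>k. a0 i * q (k - i))"
  have fs: "(\<lambda>n. a0 n * z ^ n) sums f z" if "z \<in> \<bbbD>" for z
    using a that sums_Suc[of "\<lambda>n. a0 n * z ^ n" "f z"] by (auto simp: has_coeffs_def a0_def)
  have cs: "(\<lambda>n. c n * z ^ n) sums (f z * (\<Sum>k\<le>Suc N. q k * z ^ k))" if z: "z \<in> \<bbbD>" for z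
  proof -
    have "norm z < 1"
      using z by simp
    \<comment> \<open>Convergence at s gives the absolute convergence at z that the Cauchy product
      requires.\<close>
    then obtain s where s: "norm z < s" "s < 1"
      using dense by blast
    have s': "norm (complex_of_real s) = s"
      using le_less_trans[OF norm_ge_zero s(1)] by simp
    have "summable (\<lambda>n. a0 n * of_real s ^ n)"
      using fs[of "of_real s"] s s' by (auto simp: sums_iff)
    then have 1: "summable (\<lambda>n. norm (a0 n * z ^ n))"
      by (rule powser_insidea) (use s s' in auto)
    have 2: "summable (\<lambda>n. norm (q n * z ^ n))"
      by (rule summable_finite[of "{..N}"]) (auto simp: q_def)
    have "(\<lambda>k. \<Sum>i\<le>k. (a0 i * z ^ i) * (q (k - i) * z ^ (k - i))) sums
             ((\<Sum>n. a0 n * z ^ n) * (\<Sum>n. q n * z ^ n))"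
      by (rule Cauchy_product_sums[OF 1 2])
    also have "(\<lambda>k. \<Sum>i\<le>k. (a0 i * z ^ i) * (q (k - i) * z ^ (k - i))) = (\<lambda>n. c n * z ^ n)"
      by (auto simp: c_def sum_distrib_right fun_eq_iff simp flip: power_add intro!: sum.cong)
    also have "(\<Sum>n. a0 n * z ^ n) = f z"
      using fs[OF z] by (simp add: sums_iff)
    also have "(\<Sum>n. q n * z ^ n) = (\<Sum>k\<le>Suc N. q k * z ^ k)"
      using polynomial_sums[of "Suc N" q z] by (auto simp: sums_iff q_def)
    finally show ?thesis .
  qed
  have "norm (f z * (\<Sum>k\<le>Suc N. q k * z ^ k)) \<le> norm (\<Sum>k\<le>Suc N. q k * z ^ k)" if "z \<in> \<bbbD>" for z
    using f that by (auto simp: bounded_class_def norm_mult intro!: mult_left_le_one_le)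
  \<comment> \<open>The zero of f at 0 shifts the product by one index: degree \<open>Suc N\<close>
    here corresponds to N for the shifted sequence, since \<open>c 0 = 0\<close> and
    \<open>q (Suc N) = 0\<close>.\<close>
  from bessel_polynomial_bound[OF cs this]
  have "(\<Sum>k\<le>Suc N. (norm (c k))\<^sup>2) \<le> (\<Sum>k\<le>Suc N. (norm (q k))\<^sup>2)" .
  also have "\<dots> = (\<Sum>k\<le>N. (norm (p k))\<^sup>2)"
    by (auto simp: q_def)
  also have "(\<Sum>k\<le>Suc N. (norm (c k))\<^sup>2) = (\<Sum>k\<le>N. (norm (c (Suc k)))\<^sup>2)"
    by (subst sum.atMost_Suc_shift) (simp add: c_def a0_def)
  also have "\<dots> = (\<Sum>k\<le>N. (norm (\<Sum>i\<le>k. a (Suc i) * p (k - i)))\<^sup>2)"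
  proof (intro sum.cong refl)
    fix k assume "k \<in> {..N}"
    then have "c (Suc k) = (\<Sum>i\<le>k. a (Suc i) * p (k - i))"
      unfolding c_def by (subst sum.atMost_Suc_shift) (auto simp: a0_def q_def intro!: sum.cong)
    then show "(norm (c (Suc k)))\<^sup>2 = (norm (\<Sum>i\<le>k. a (Suc i) * p (k - i)))\<^sup>2"
      by simp
  qed
  finally show ?thesis .
qed

lemma unimodular_polar:
  obtains \<omega> :: complex where "norm \<omega> = 1" "c = \<omega> * norm c"
proof (cases "c = 0")
  case True
  with that[of 1] show ?thesis by simp
next
  case False
  then have "norm (sgn c) = 1"
    by (simp add: norm_sgn)
  moreover have "c = sgn c * norm c"
    using False by (simp add: sgn_eq)
  ultimately show ?thesis using that by blast
qed

lemma sum_atMost_rev: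
  fixes g :: "nat \<Rightarrow> 'a :: comm_monoid_add"
  shows "(\<Sum>k\<le>N. g k) = (\<Sum>i\<le>N. g (N - i))"
  by (rule sum.reindex_bij_witness[of _ "\<lambda>i. N - i" "\<lambda>i. N - i"]) auto

section \<open>Carlson's inequalities and the refined majorant series\<close>

text \<open>The property through which the function enters: truncated convolution with b is a
  contraction in every length.\<close>

locale convolution_contraction =
  fixes b :: "nat \<Rightarrow> complex"
  assumes contraction: "(\<Sum>k\<le>N. (norm (\<Sum>i\<le>k. b i * p (k - i)))\<^sup>2) \<le> (\<Sum>k\<le>N. (norm (p k))\<^sup>2)"
begin

text \<open>The test vector is the one for which the contraction inequality is sharp: its upper half is
  the conjugate reversal of \<open>b\<close>, rotated by the phase of \<open>b N\<close>, so that every term of the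
  convolution at the top index \<open>N\<close> has the same phase.\<close>

lemma carlson_odd:
  "norm (b (2 * n + 1)) + (\<Sum>k\<le>n. (norm (b k))\<^sup>2) \<le> 1"
proof -
  define N where "N = 2 * n + 1"
  define S where "S = (\<Sum>k\<le>n. (norm (b k))\<^sup>2)"
  obtain \<omega> :: complex where \<omega>: "norm \<omega> = 1" "b N = \<omega> * norm (b N)"
    using unimodular_polar[of "b N"] .
  define p where "p = (\<lambda>k. if k = 0 then 1 else if N - k \<le> n then \<omega> * cnj (b (N - k)) else 0)"
  define h where "h = (\<lambda>k. \<Sum>i\<le>k. b i * p (k - i))"
  have p_rev: "p (N - i) = (if i = N then 1 else if i \<le> n then \<omega> * cnj (b i) else 0)" if "i \<le> N" for i
    using that by (auto simp: p_def)
  have p_low: "p (N - i) = \<omega> * cnj (b i)" if "i \<le> n" for i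
    using that by (subst p_rev) (auto simp: N_def)
  have split: "(\<Sum>i\<le>N. g i) = (\<Sum>i\<le>n. g i) + g N"
    if "\<And>i. n < i \<Longrightarrow> i < N \<Longrightarrow> g i = 0" for g :: "nat \<Rightarrow> 'b :: comm_monoid_add"
  proof -
    have "(\<Sum>i\<le>N. g i) = (\<Sum>i\<in>insert N {..n}. g i)"
      by (rule sum.mono_neutral_right) (use that in \<open>auto simp: N_def\<close>)
    then show ?thesis
      by (simp add: N_def add.commute)
  qed
  have norm_p: "(\<Sum>k\<le>N. (norm (p k))\<^sup>2) = S + 1"
  proof -
    have "(\<Sum>k\<le>N. (norm (p k))\<^sup>2) = (\<Sum>i\<le>N. (norm (p (N - i)))\<^sup>2)"
      by (rule sum_atMost_rev)
    also have "\<dots> = (\<Sum>i\<le>n. (norm (p (N - i)))\<^sup>2) + (norm (p (N - N)))\<^sup>2"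
      by (rule split) (auto simp: p_rev)
    also have "\<dots> = S + 1"
      unfolding S_def using \<omega>(1) by (simp add: p_low norm_mult) (simp add: p_def)
    finally show ?thesis .
  qed
  \<comment> \<open>p vanishes at the indices 1 to n, so only \<open>p 0 = 1\<close>
    contributes.\<close>
  have h_low: "h k = b k" if "k \<le> n" for k
  proof -
    have "h k = (\<Sum>i\<le>k. if i = k then b i else 0)"
      unfolding h_def using that by (intro sum.cong) (auto simp: p_def N_def)
    then show ?thesis by simp
  qed
  have "h N = (\<Sum>i\<le>n. b i * p (N - i)) + b N * p (N - N)"
    unfolding h_def by (rule split) (auto simp: p_rev)
  also have "(\<Sum>i\<le>n. b i * p (N - i)) = \<omega> * S"
    unfolding S_def of_real_sum sum_distrib_left
    by (rule sum.cong) (auto simp: p_low complex_norm_square mult_ac simp flip: of_real_power)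
  also have "b N * p (N - N) = \<omega> * norm (b N)"
    using \<omega> by (simp add: p_def)
  finally have "norm (h N) = norm (\<omega> * of_real (S + norm (b N)))"
    by (simp add: algebra_simps)
  also have "\<dots> = norm (b N) + S"
    unfolding norm_mult \<omega>(1) norm_of_real by (simp add: S_def sum_nonneg)
  finally have hN: "norm (h N) = norm (b N) + S" .
  \<comment> \<open>Dropping the indices strictly between n and N leaves S on both sides; it cancels
    and bounds \<open>h N\<close> alone.\<close>
  have "S + (norm (h N))\<^sup>2 = (\<Sum>k\<in>insert N {..n}. (norm (h k))\<^sup>2)"
    by (auto simp: S_def N_def h_low)
  also have "\<dots> \<le> (\<Sum>k\<le>N. (norm (h k))\<^sup>2)"
    by (rule sum_mono2) (auto simp: N_def)
  also have "\<dots> \<le> S + 1"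
    using contraction[where p = p and N = N] unfolding norm_p h_def .
  finally have "(norm (b N) + S)\<^sup>2 \<le> 1"
    unfolding hN by simp
  then have "norm (b N) + S \<le> 1"
    using abs_square_le_1 abs_le_D1 by blast
  then show ?thesis
    by (simp add: N_def S_def)
qed

text \<open>The scheme of \<open>carlson_odd\<close> with \<open>N = 2 * n\<close>. The index n is
  now fixed by the reversal k to \<open>N - k\<close>, and there the convolution also meets
  \<open>b 0\<close>, which costs the factor \<open>1 / (1 + norm (b 0))\<close>.\<close>

lemma carlson_even:
  assumes n: "0 < n"
  shows "norm (b (2 * n)) + (\<Sum>k<n. (norm (b k))\<^sup>2) + (norm (b n))\<^sup>2 / (1 + norm (b 0)) \<le> 1"
proof -
  define N where "N = 2 * n"
  define S where "S = (\<Sum>k<n. (norm (b k))\<^sup>2)"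
  \<comment> \<open>The weight \<open>m\<close> solves \<open>1 - m \<bar>b 0\<bar> = m\<close>: then the contribution of the middle index \<open>n\<close>
    to the left-hand side dominates its contribution to the norm of the test vector.\<close>
  define m where "m = 1 / (1 + norm (b 0))"
  obtain \<omega> :: complex where \<omega>: "norm \<omega> = 1" "b N = \<omega> * norm (b N)"
    using unimodular_polar[of "b N"] .
  define p where "p = (\<lambda>k. if k = 0 then 1 else if k = n then \<omega> * m * cnj (b n)
                           else if N - k < n then \<omega> * cnj (b (N - k)) else 0)"
  define h where "h = (\<lambda>k. \<Sum>i\<le>k. b i * p (k - i))"
  have m: "0 < m" "1 - m * norm (b 0) = m"
    using add_pos_nonneg[of 1 "norm (b 0)"] by (simp_all add: m_def divide_simps)
  have p_rev: "p (N - i) = (if i = N then 1 else if i = n then \<omega> * m * cnj (b n)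
                            else if i < n then \<omega> * cnj (b i) else 0)" if "i \<le> N" for i
    using that n by (auto simp: p_def N_def)
  have p_low: "p (N - i) = \<omega> * cnj (b i)" if "i < n" for i
    using that by (subst p_rev) (auto simp: N_def)
  have split: "(\<Sum>i\<le>N. g i) = (\<Sum>i<n. g i) + g n + g N"
    if "\<And>i. n < i \<Longrightarrow> i < N \<Longrightarrow> g i = 0" for g :: "nat \<Rightarrow> 'b :: comm_monoid_add"
  proof -
    have "(\<Sum>i\<le>N. g i) = (\<Sum>i\<in>insert N (insert n {..<n}). g i)"
      by (rule sum.mono_neutral_right) (use that in \<open>auto simp: N_def\<close>)
    then show ?thesis
      using n by (simp add: N_def add_ac)
  qed
  have norm_p: "(\<Sum>k\<le>N. (norm (p k))\<^sup>2) = S + (m * norm (b n))\<^sup>2 + 1"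
  proof -
    have "(\<Sum>k\<le>N. (norm (p k))\<^sup>2) = (\<Sum>i\<le>N. (norm (p (N - i)))\<^sup>2)"
      by (rule sum_atMost_rev)
    also have "\<dots> = (\<Sum>i<n. (norm (p (N - i)))\<^sup>2) + (norm (p (N - n)))\<^sup>2 + (norm (p (N - N)))\<^sup>2"
      by (rule split) (auto simp: p_rev)
    also have "(\<Sum>i<n. (norm (p (N - i)))\<^sup>2) = S"
      unfolding S_def using \<omega>(1) by (simp add: p_low norm_mult)
    also have "(norm (p (N - n)))\<^sup>2 = (m * norm (b n))\<^sup>2"
      using \<omega> m n by (subst p_rev) (auto simp: N_def norm_mult)
    finally show ?thesis
      by (simp add: p_def)
  qed
  have h_low: "h k = b k" if "k < n" for k
  proof -
    have "h k = (\<Sum>i\<le>k. if i = k then b i else 0)"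
      unfolding h_def using that by (intro sum.cong) (auto simp: p_def N_def)
    then show ?thesis by simp
  qed
  have "h n = (\<Sum>i\<le>n. (if i = n then b n else 0) + (if i = 0 then b 0 * (\<omega> * m * cnj (b n)) else 0))"
    unfolding h_def using n by (intro sum.cong) (auto simp: p_def N_def)
  then have hn_eq: "h n = b n + b 0 * (\<omega> * m * cnj (b n))"
    by (simp add: sum.distrib)
  \<comment> \<open>By the reverse triangle inequality \<open>h n\<close> has norm at least
    \<open>m * norm (b n)\<close>, which pays for the middle entry of p.\<close>
  have "m * norm (b n) = norm (b n) - norm (b 0 * (\<omega> * m * cnj (b n)))"
  proof -
    have "m * norm (b n) = (1 - m * norm (b 0)) * norm (b n)"
      using m by simp
    also have "\<dots> = norm (b n) - norm (b 0 * (\<omega> * m * cnj (b n)))"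
      using m(1) \<omega>(1) by (simp add: norm_mult algebra_simps)
    finally show ?thesis .
  qed
  also have "\<dots> \<le> norm (h n)"
    unfolding hn_eq by (rule norm_diff_ineq)
  finally have hn: "(m * norm (b n))\<^sup>2 \<le> (norm (h n))\<^sup>2"
    using m by (intro power_mono) auto
  have "h N = (\<Sum>i<n. b i * p (N - i)) + b n * p (N - n) + b N * p (N - N)"
    unfolding h_def by (rule split) (auto simp: p_rev)
  also have "(\<Sum>i<n. b i * p (N - i)) = \<omega> * S"
    unfolding S_def of_real_sum sum_distrib_left
    by (rule sum.cong) (auto simp: p_low complex_norm_square mult_ac simp flip: of_real_power)
  also have "b N * p (N - N) = \<omega> * norm (b N)"
    using \<omega> by (simp add: p_def)
  also have "b n * p (N - n) = \<omega> * of_real (m * (norm (b n))\<^sup>2)"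
    using n by (subst p_rev) (auto simp: N_def complex_norm_square simp flip: of_real_power)
  finally have "norm (h N) = norm (\<omega> * of_real (S + m * (norm (b n))\<^sup>2 + norm (b N)))"
    by (simp add: algebra_simps)
  also have "\<dots> = norm (b N) + S + m * (norm (b n))\<^sup>2"
    unfolding norm_mult \<omega>(1) norm_of_real using m by (simp add: S_def sum_nonneg)
  finally have hN: "norm (h N) = norm (b N) + S + m * (norm (b n))\<^sup>2" .
  have "S + (norm (h n))\<^sup>2 + (norm (h N))\<^sup>2 = (\<Sum>k\<in>insert N (insert n {..<n}). (norm (h k))\<^sup>2)"
    using n by (auto simp: S_def N_def h_low)
  also have "\<dots> \<le> (\<Sum>k\<le>N. (norm (h k))\<^sup>2)"
    by (rule sum_mono2) (auto simp: N_def)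
  also have "\<dots> \<le> S + (m * norm (b n))\<^sup>2 + 1"
    using contraction[where p = p and N = N] unfolding norm_p h_def .
  finally have "(norm (b N) + S + m * (norm (b n))\<^sup>2)\<^sup>2 \<le> 1"
    unfolding hN using hn by simp
  then have "norm (b N) + S + m * (norm (b n))\<^sup>2 \<le> 1"
    using abs_square_le_1 abs_le_D1 by blast
  then show ?thesis
    by (simp add: N_def S_def m_def)
qed

lemma norm_b_le_1: "norm (b n) \<le> 1"
proof -
  have "(norm (b n))\<^sup>2 \<le> (\<Sum>k\<le>n. (norm (b k))\<^sup>2)"
    by (rule member_le_sum) auto
  also have "\<dots> \<le> 1"
    using carlson_odd[of n] norm_ge_zero[of "b (2 * n + 1)"] by linarith
  finally show ?thesis
    using abs_square_le_1 abs_le_D1 by blast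
qed

text \<open>Carlson's inequalities enter with every \<open>\<bar>b k\<bar>\<^sup>2\<close> subtracted from the bounds of all later
  coefficients; the second summand on the right is the part of these subtractions that belongs to
  indices beyond \<open>2 M + 1\<close> and has not been used yet. It makes the induction step an identity.\<close>

lemma refined_majorant_partial_sum:
  fixes r :: real
  assumes r: "0 \<le> r" "r < 1"
  defines "\<alpha> \<equiv> norm (b 0)"
  shows "(\<Sum>k<2*M+1. norm (b (Suc k)) * r ^ Suc k) +
           (1 / (1 + \<alpha>) + r / (1 - r)) * (\<Sum>k<M. (norm (b (Suc k)))\<^sup>2 * r ^ (2 * Suc k))
         \<le> ((1 - \<alpha>\<^sup>2) * (r - r ^ (2 * M + 2)) +
              (\<Sum>k<M. (norm (b (Suc k)))\<^sup>2) * r ^ (2 * M + 2)) / (1 - r)"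
proof (induction M)
  case 0
  have "norm (b 1) \<le> 1 - \<alpha>\<^sup>2"
    using carlson_odd[of 0] by (simp add: \<alpha>_def)
  from mult_right_mono[OF this r(1)] have "norm (b 1) * r \<le> (1 - \<alpha>\<^sup>2) * r" .
  moreover have "(1 - \<alpha>\<^sup>2) * (r - r\<^sup>2) / (1 - r) = (1 - \<alpha>\<^sup>2) * r"
    using r by (simp add: field_simps power2_eq_square)
  ultimately show ?case
    by (simp add: power2_eq_square)
next
  case (Suc M)
  define S where "S = (\<Sum>k<M. (norm (b (Suc k)))\<^sup>2)"
  define q where "q = r ^ (2 * M + 2)"
  define y where "y = (norm (b (Suc M)))\<^sup>2"
  have q: "0 \<le> q"
    using r by (simp add: q_def)
  have "(\<Sum>k<Suc M. (norm (b k))\<^sup>2) = \<alpha>\<^sup>2 + S"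
    unfolding sum.lessThan_Suc_shift by (simp add: S_def \<alpha>_def)
  with carlson_even[of "Suc M"]
  have even: "norm (b (2 * M + 2)) \<le> 1 - \<alpha>\<^sup>2 - S - y / (1 + \<alpha>)"
    by (simp add: y_def \<alpha>_def)
  have "(\<Sum>k\<le>Suc M. (norm (b k))\<^sup>2) = \<alpha>\<^sup>2 + S + y"
    unfolding sum.atMost_Suc_shift by (simp add: S_def \<alpha>_def y_def lessThan_Suc_atMost[symmetric])
  with carlson_odd[of "Suc M"]
  have odd: "norm (b (2 * M + 3)) \<le> 1 - \<alpha>\<^sup>2 - S - y"
    by (simp add: eval_nat_numeral)
  \<comment> \<open>The weight is the total saving due to y: \<open>y * q / (1 + \<alpha>)\<close>
    from the even coefficient, and y times
    \<open>q * r + q * r\<^sup>2 + ... = q * r / (1 - r)\<close> from all later ones.\<close>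
  have "norm (b (2 * M + 2)) * q + norm (b (2 * M + 3)) * (q * r) + (1 / (1 + \<alpha>) + r / (1 - r)) * (y * q)
      \<le> (1 - \<alpha>\<^sup>2 - S - y / (1 + \<alpha>)) * q + (1 - \<alpha>\<^sup>2 - S - y) * (q * r) + (1 / (1 + \<alpha>) + r / (1 - r)) * (y * q)"
    using even odd q r by (intro add_mono mult_right_mono order.refl) auto
  also have "\<dots> = ((1 - \<alpha>\<^sup>2) * (r - q * r\<^sup>2) + (S + y) * (q * r\<^sup>2)) / (1 - r)
               - ((1 - \<alpha>\<^sup>2) * (r - q) + S * q) / (1 - r)"
  proof -
    \<comment> \<open>Naming the reciprocals turns the claim into a polynomial identity modulo
      \<open>(1 - r) * \<tau> = 1\<close>.\<close>
    define \<tau> where "\<tau> = 1 / (1 - r)"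
    define \<kappa> where "\<kappa> = 1 / (1 + \<alpha>)"
    have \<tau>: "(1 - r) * \<tau> = 1"
      using r by (simp add: \<tau>_def)
    have div: "x / (1 - r) = x * \<tau>" "x / (1 + \<alpha>) = x * \<kappa>" for x
      by (simp_all add: \<tau>_def \<kappa>_def)
    show ?thesis
      unfolding div using \<tau> by algebra
  qed
  finally have step: "norm (b (2 * M + 2)) * q + norm (b (2 * M + 3)) * (q * r)
      + (1 / (1 + \<alpha>) + r / (1 - r)) * (y * q)
      \<le> ((1 - \<alpha>\<^sup>2) * (r - q * r\<^sup>2) + (S + y) * (q * r\<^sup>2)) / (1 - r)
               - ((1 - \<alpha>\<^sup>2) * (r - q) + S * q) / (1 - r)" .
  have "(\<Sum>k<2 * Suc M + 1. norm (b (Suc k)) * r ^ Suc k) =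
          (\<Sum>k<2 * M + 1. norm (b (Suc k)) * r ^ Suc k) +
          (norm (b (2 * M + 2)) * q + norm (b (2 * M + 3)) * (q * r))"
    by (simp add: q_def eval_nat_numeral mult_ac)
  moreover have "(1 / (1 + \<alpha>) + r / (1 - r)) * (\<Sum>k<Suc M. (norm (b (Suc k)))\<^sup>2 * r ^ (2 * Suc k)) =
          (1 / (1 + \<alpha>) + r / (1 - r)) * (\<Sum>k<M. (norm (b (Suc k)))\<^sup>2 * r ^ (2 * Suc k)) +
          (1 / (1 + \<alpha>) + r / (1 - r)) * (y * q)"
    unfolding sum.lessThan_Suc distrib_left[of "1 / (1 + \<alpha>) + r / (1 - r)"] by (simp add: q_def y_def)
  moreover have pow: "r ^ (2 * Suc M + 2) = q * r\<^sup>2"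
    by (simp add: q_def power2_eq_square mult_ac)
  moreover have sq: "(\<Sum>k<Suc M. (norm (b (Suc k)))\<^sup>2) = S + y"
    by (simp add: S_def y_def)
  moreover note Suc.IH[folded S_def q_def] step
  ultimately show ?case
    unfolding pow sq by linarith
qed

lemma summable_coeff_power:
  fixes r :: real
  assumes r: "0 \<le> r" "r < 1"
  shows "summable (\<lambda>n. norm (b n) * r ^ n)" "summable (\<lambda>n. (norm (b n))\<^sup>2 * r ^ (2 * n))"
proof -
  have "norm (norm (b n) * r ^ n) \<le> r ^ n" for n
    using r norm_b_le_1[of n] by (simp add: norm_mult mult_left_le_one_le)
  then show "summable (\<lambda>n. norm (b n) * r ^ n)"
    using r by (intro summable_comparison_test'[OF summable_geometric[of r]]) auto
  have "(norm (b n))\<^sup>2 \<le> 1" for n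
    using norm_b_le_1[of n] by (simp add: abs_square_le_1)
  then have "norm ((norm (b n))\<^sup>2 * r ^ (2 * n)) \<le> (r\<^sup>2) ^ n" for n
    using r by (simp add: norm_mult mult_left_le_one_le power_mult)
  moreover have "norm (r\<^sup>2) < 1"
    using r by (simp add: abs_square_less_1)
  ultimately show "summable (\<lambda>n. (norm (b n))\<^sup>2 * r ^ (2 * n))"
    by (intro summable_comparison_test'[OF summable_geometric[of "r\<^sup>2"]]) auto
qed

text \<open>Let M tend to infinity in the partial sums. The squares after \<open>b 0\<close> sum to
  at most \<open>1 - \<alpha>\<^sup>2\<close> by \<open>carlson_odd\<close>, so the two terms with
  \<open>r ^ (2 * M + 2)\<close> are together at most 0.\<close>

lemma refined_majorant_bound:
  fixes r :: real
  assumes r: "0 \<le> r" "r < 1"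
  defines "\<alpha> \<equiv> norm (b 0)"
  shows "(\<Sum>k. norm (b (Suc k)) * r ^ Suc k) +
           (1 / (1 + \<alpha>) + r / (1 - r)) * (\<Sum>k. (norm (b (Suc k)))\<^sup>2 * r ^ (2 * Suc k))
         \<le> (1 - \<alpha>\<^sup>2) * r / (1 - r)"
proof -
  have 1: "(\<lambda>M. \<Sum>k<M. norm (b (Suc k)) * r ^ Suc k) \<longlonglongrightarrow> (\<Sum>k. norm (b (Suc k)) * r ^ Suc k)"
    by (rule summable_LIMSEQ[OF summable_ignore_initial_segment[OF summable_coeff_power(1)[OF r], of 1, unfolded add_Suc_right add_0_right One_nat_def]])
  have 2: "(\<lambda>M. \<Sum>k<M. (norm (b (Suc k)))\<^sup>2 * r ^ (2 * Suc k))
             \<longlonglongrightarrow> (\<Sum>k. (norm (b (Suc k)))\<^sup>2 * r ^ (2 * Suc k))"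
    by (rule summable_LIMSEQ[OF summable_ignore_initial_segment[OF summable_coeff_power(2)[OF r], of 1, unfolded add_Suc_right add_0_right One_nat_def]])
  have "strict_mono (\<lambda>M::nat. 2 * M + 1)"
    by (auto simp: strict_mono_def)
  from LIMSEQ_subseq_LIMSEQ[OF 1 this]
  have 3: "(\<lambda>M. \<Sum>k<2*M+1. norm (b (Suc k)) * r ^ Suc k) \<longlonglongrightarrow> (\<Sum>k. norm (b (Suc k)) * r ^ Suc k)"
    by (simp add: o_def)
  have "(\<Sum>k<2*M+1. norm (b (Suc k)) * r ^ Suc k) +
           (1 / (1 + \<alpha>) + r / (1 - r)) * (\<Sum>k<M. (norm (b (Suc k)))\<^sup>2 * r ^ (2 * Suc k))
        \<le> (1 - \<alpha>\<^sup>2) * r / (1 - r)" for M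
  proof -
    have "(\<Sum>k\<le>M. (norm (b k))\<^sup>2) = \<alpha>\<^sup>2 + (\<Sum>k<M. (norm (b (Suc k)))\<^sup>2)"
      unfolding lessThan_Suc_atMost[symmetric] sum.lessThan_Suc_shift by (simp add: \<alpha>_def)
    with carlson_odd[of M] norm_ge_zero[of "b (2 * M + 1)"]
    have "(\<Sum>k<M. (norm (b (Suc k)))\<^sup>2) \<le> 1 - \<alpha>\<^sup>2"
      by linarith
    then have "(\<Sum>k<M. (norm (b (Suc k)))\<^sup>2) * r ^ (2 * M + 2) \<le> (1 - \<alpha>\<^sup>2) * r ^ (2 * M + 2)"
      using r by (intro mult_right_mono) auto
    then have "((1 - \<alpha>\<^sup>2) * (r - r ^ (2 * M + 2)) +
              (\<Sum>k<M. (norm (b (Suc k)))\<^sup>2) * r ^ (2 * M + 2)) / (1 - r) \<le> (1 - \<alpha>\<^sup>2) * r / (1 - r)"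
      using r by (intro divide_right_mono) (auto simp: algebra_simps)
    with refined_majorant_partial_sum[OF r, of M] show ?thesis
      unfolding \<alpha>_def by linarith
  qed
  then show ?thesis
    using LIMSEQ_le_const2[OF tendsto_add[OF 3 tendsto_mult_left[OF 2]]] by blast
qed

end

section \<open>Reduction of the Bohr sums to the shifted coefficients\<close>

lemma bounded_class_convolution_contraction:
  assumes "f \<in> \<B>" "has_coeffs f a"
  shows "convolution_contraction (\<lambda>n. a (Suc n))"
  by unfold_locales (rule bounded_class_convolution_contractive[OF assms])

text \<open>Both sums contain the same U, to which \<open>refined_majorant_bound\<close> applies.
  The weight in \<open>bohr_sum_norm\<close> is \<open>K / r\<close>, so its squares of index 2 and
  higher match those of \<open>bohr_sum_tail\<close>, and the square of \<open>a 1\<close> adds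
  \<open>K * \<alpha>\<^sup>2 * r\<close>.\<close>

lemma bohr_sums_via_shifted_coeffs:
  fixes r :: real
  assumes "convolution_contraction (\<lambda>n. a (Suc n))" and r: "0 \<le> r" "r < 1"
  defines "\<alpha> \<equiv> norm (a 1)"
  defines "K \<equiv> 1 / (1 + \<alpha>) + r / (1 - r)"
  defines "U \<equiv> (\<Sum>k. norm (a (Suc (Suc k))) * r ^ Suc k) +
                K * (\<Sum>k. (norm (a (Suc (Suc k))))\<^sup>2 * r ^ (2 * Suc k))"
  shows "bohr_sum_tail a r = \<alpha> * r + r * U"
    and "0 < r \<Longrightarrow> bohr_sum_norm a r = \<alpha> * r + r * U + K * \<alpha>\<^sup>2 * r"
proof -
  interpret convolution_contraction "\<lambda>n. a (Suc n)" by fact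
  define M1 where "M1 = (\<Sum>k. norm (a (Suc (Suc k))) * r ^ Suc k)"
  define M2 where "M2 = (\<Sum>k. (norm (a (Suc (Suc k))))\<^sup>2 * r ^ (2 * Suc k))"
  note sm = summable_coeff_power[OF r]
  have "majorant a r = (\<Sum>n. r * (norm (a (Suc n)) * r ^ n))"
    by (simp add: majorant_def mult_ac)
  also have "\<dots> = r * (\<Sum>n. norm (a (Suc n)) * r ^ n)"
    by (rule suminf_mult[OF sm(1)])
  also have "(\<Sum>n. norm (a (Suc n)) * r ^ n) = M1 + \<alpha>"
    using suminf_split_head[OF sm(1)] by (simp add: M1_def \<alpha>_def)
  finally have maj: "majorant a r = \<alpha> * r + r * M1"
    by (simp add: algebra_simps)
  have "sq_norm a r = (\<Sum>n. r\<^sup>2 * ((norm (a (Suc n)))\<^sup>2 * r ^ (2 * n)))"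
    by (simp add: sq_norm_def mult_ac power2_eq_square)
  also have "\<dots> = r\<^sup>2 * (\<Sum>n. (norm (a (Suc n)))\<^sup>2 * r ^ (2 * n))"
    by (rule suminf_mult[OF sm(2)])
  also have "(\<Sum>n. (norm (a (Suc n)))\<^sup>2 * r ^ (2 * n)) = M2 + \<alpha>\<^sup>2"
    using suminf_split_head[OF sm(2)] by (simp add: M2_def \<alpha>_def)
  finally have sq: "sq_norm a r = r\<^sup>2 * (\<alpha>\<^sup>2 + M2)"
    by (simp add: algebra_simps)
  have "(\<Sum>n. (norm (a (n + 2)))\<^sup>2 * r ^ (2 * (n + 2) - 1)) =
        (\<Sum>n. r * ((norm (a (Suc (Suc n))))\<^sup>2 * r ^ (2 * Suc n)))"
    by (simp add: mult_ac)
  also have "\<dots> = r * M2"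
    unfolding M2_def
    by (rule suminf_mult) (use summable_ignore_initial_segment[OF sm(2), of 1] in simp)
  finally have tail: "(\<Sum>n. (norm (a (n + 2)))\<^sup>2 * r ^ (2 * (n + 2) - 1)) = r * M2" .
  show "bohr_sum_tail a r = \<alpha> * r + r * U"
    unfolding bohr_sum_tail_def maj tail U_def M1_def[symmetric] M2_def[symmetric] K_def \<alpha>_def
    by (simp add: algebra_simps)
  show "bohr_sum_norm a r = \<alpha> * r + r * U + K * \<alpha>\<^sup>2 * r" if "0 < r"
  proof -
    have "(inverse r / (1 + \<alpha>) + 1 / (1 - r)) * r\<^sup>2 = K * r"
    proof -
      have div: "x / (1 + \<alpha>) = x * (1 / (1 + \<alpha>))" "x / (1 - r) = x * (1 / (1 - r))" for x
        by simp_all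
      have "r * inverse r = 1"
        using that by simp
      then show ?thesis
        unfolding K_def div[of "inverse r"] div(2)[of r] by algebra
    qed
    then have "(inverse r / (1 + \<alpha>) + 1 / (1 - r)) * sq_norm a r = K * r * (\<alpha>\<^sup>2 + M2)"
      unfolding sq by (simp only: mult.assoc[symmetric])
    then show ?thesis
      unfolding bohr_sum_norm_def maj U_def M1_def[symmetric] M2_def[symmetric] \<alpha>_def
      by (simp add: algebra_simps)
  qed
qed

section \<open>Sharp bounds and extremal functions\<close>

text \<open>This and \<open>norm_bound\<close> are the largest values of the two Bohr sums at radius
  r when \<open>\<bar>a 1\<bar> = \<alpha>\<close>, attained by
  \<open>extremal \<alpha>\<close>.\<close>

definition tail_bound :: "real \<Rightarrow> real \<Rightarrow> real" where
  "tail_bound \<alpha> r = \<alpha> * r + (1 - \<alpha>\<^sup>2) * r\<^sup>2 / (1 - r)"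

definition norm_bound :: "real \<Rightarrow> real \<Rightarrow> real" where
  "norm_bound \<alpha> r = tail_bound \<alpha> r + (1 / (1 + \<alpha>) + r / (1 - r)) * \<alpha>\<^sup>2 * r"

lemma bohr_sum_le_bound:
  fixes r :: real
  assumes "f \<in> \<B>" "has_coeffs f a" and r: "0 \<le> r" "r < 1"
  shows "bohr_sum_tail a r \<le> tail_bound (norm (a 1)) r"
    and "0 < r \<Longrightarrow> bohr_sum_norm a r \<le> norm_bound (norm (a 1)) r"
proof -
  have cc: "convolution_contraction (\<lambda>n. a (Suc n))"
    by (rule bounded_class_convolution_contraction) fact+
  interpret convolution_contraction "\<lambda>n. a (Suc n)" by (rule cc)
  note bound = mult_left_mono[OF refined_majorant_bound[OF r] r(1)]
  show "bohr_sum_tail a r \<le> tail_bound (norm (a 1)) r"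
    unfolding bohr_sums_via_shifted_coeffs(1)[OF cc r] tail_bound_def
    using bound by (simp add: power2_eq_square mult_ac)
  show "bohr_sum_norm a r \<le> norm_bound (norm (a 1)) r" if "0 < r"
    unfolding bohr_sums_via_shifted_coeffs(2)[OF cc r that] norm_bound_def tail_bound_def
    using bound by (simp add: power2_eq_square mult_ac)
qed

lemma norm_first_coeff_le_1:
  assumes "f \<in> \<B>" "has_coeffs f a"
  shows "norm (a 1) \<le> 1"
  using convolution_contraction.norm_b_le_1[OF bounded_class_convolution_contraction[OF assms], of 0]
  by simp

text \<open>z times the involution of the disk that swaps 0 and \<alpha>; for \<alpha> = 1 it
  degenerates to the identity on the disk.\<close>

definition extremal :: "real \<Rightarrow> complex \<Rightarrow> complex" where
  "extremal \<alpha> z = z * ((\<alpha> - z) / (1 - \<alpha> * z))"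

definition extremal_coeff :: "real \<Rightarrow> nat \<Rightarrow> complex" where
  "extremal_coeff \<alpha> n = (if n = 0 then 0 else if n = 1 then \<alpha> else - ((1 - \<alpha>\<^sup>2) * \<alpha> ^ (n - 2)))"

lemma extremal_denominator_nonzero:
  fixes \<alpha> :: real and z :: complex
  assumes "0 \<le> \<alpha>" "\<alpha> \<le> 1" "z \<in> \<bbbD>"
  shows "norm (\<alpha> * z) < 1" "1 - \<alpha> * z \<noteq> 0"
proof -
  have "norm (\<alpha> * z) \<le> 1 * norm z"
    unfolding norm_mult using assms by (intro mult_right_mono) auto
  also have "\<dots> < 1"
    using assms by simp
  finally show "norm (\<alpha> * z) < 1" .
  then show "1 - \<alpha> * z \<noteq> 0"
    by auto
qed

lemma one_minus_mult_norm_diff: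
  fixes \<alpha> :: real and z :: complex
  shows "(1 - \<alpha>\<^sup>2) * (1 - (norm z)\<^sup>2) = (norm (1 - \<alpha> * z))\<^sup>2 - (norm (\<alpha> - z))\<^sup>2"
  unfolding cmod_power2 by (simp add: power2_eq_square) (simp add: algebra_simps)

lemma extremal_bounded_class:
  assumes \<alpha>: "0 \<le> \<alpha>" "\<alpha> \<le> 1"
  shows "extremal \<alpha> \<in> \<B>"
proof -
  have "extremal \<alpha> holomorphic_on \<bbbD>"
    unfolding extremal_def[abs_def]
    by (intro holomorphic_intros extremal_denominator_nonzero(2)[OF \<alpha>])
  moreover have "norm (extremal \<alpha> z) \<le> 1" if z: "z \<in> \<bbbD>" for z
  proof -
    have z1: "(norm z)\<^sup>2 \<le> 1"
      using z by (simp add: abs_square_le_1)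
    have "\<alpha>\<^sup>2 \<le> 1"
      using \<alpha> by (simp add: abs_square_le_1)
    with z1 have "0 \<le> (1 - \<alpha>\<^sup>2) * (1 - (norm z)\<^sup>2)"
      by (intro mult_nonneg_nonneg) (simp_all only: diff_ge_0_iff_ge)
    then have "(norm (\<alpha> - z))\<^sup>2 \<le> (norm (1 - \<alpha> * z))\<^sup>2"
      by (simp add: one_minus_mult_norm_diff)
    then have "norm (\<alpha> - z) \<le> norm (1 - \<alpha> * z)"
      by (rule power2_le_imp_le) simp
    then have "norm ((\<alpha> - z) / (1 - \<alpha> * z)) \<le> 1"
      using extremal_denominator_nonzero(2)[OF \<alpha> z]
      by (simp add: norm_divide divide_le_eq_1_pos del: right_minus_eq)
    moreover have "norm z \<le> 1"
      using z by simp
    ultimately show ?thesis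
      unfolding extremal_def norm_mult[of z] by (intro mult_le_one norm_ge_zero)
  qed
  ultimately show ?thesis
    by (simp add: bounded_class_def analytic_on_open)
qed

lemma extremal_has_coeffs:
  assumes \<alpha>: "0 \<le> \<alpha>" "\<alpha> \<le> 1"
  shows "has_coeffs (extremal \<alpha>) (extremal_coeff \<alpha>)"
  unfolding has_coeffs_def
proof
  fix z assume z: "z \<in> \<bbbD>"
  note nz = extremal_denominator_nonzero[OF \<alpha> z]
  \<comment> \<open>From index 2 on the series is geometric; the linear term is restored at the end
    by \<open>sums_Suc_iff\<close>.\<close>
  have "(\<lambda>n. - ((1 - \<alpha>\<^sup>2) * z\<^sup>2) * (\<alpha> * z) ^ n) sums (- ((1 - \<alpha>\<^sup>2) * z\<^sup>2) * (1 / (1 - \<alpha> * z)))"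
    by (intro sums_mult geometric_sums nz)
  also have "(\<lambda>n. - ((1 - \<alpha>\<^sup>2) * z\<^sup>2) * (\<alpha> * z) ^ n) =
             (\<lambda>n. extremal_coeff \<alpha> (Suc (Suc n)) * z ^ Suc (Suc n))"
    by (rule ext) (simp add: extremal_coeff_def power_mult_distrib power2_eq_square mult_ac)
  also have "- ((1 - \<alpha>\<^sup>2) * z\<^sup>2) * (1 / (1 - \<alpha> * z)) =
             extremal \<alpha> z - extremal_coeff \<alpha> (Suc 0) * z ^ Suc 0"
  proof -
    define u where "u = 1 / (1 - \<alpha> * z)"
    have u: "(1 - \<alpha> * z) * u = 1"
      using nz(2) by (simp add: u_def)
    have "- ((1 - \<alpha>\<^sup>2) * z\<^sup>2) * u = z * ((\<alpha> - z) * u) - \<alpha> * z"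
      unfolding of_real_diff of_real_power of_real_1 using u by algebra
    then show ?thesis
      by (simp add: extremal_def extremal_coeff_def u_def)
  qed
  finally show "(\<lambda>n. extremal_coeff \<alpha> (Suc n) * z ^ Suc n) sums extremal \<alpha> z"
    by (subst (asm) sums_Suc_iff) simp
qed

lemma norm_extremal_coeff_1:
  assumes "0 \<le> \<alpha>"
  shows "norm (extremal_coeff \<alpha> 1) = \<alpha>"
  using assms by (simp add: extremal_coeff_def)

text \<open>The majorant and the squares are both geometric series, with ratios
  \<open>\<alpha> * r\<close> and \<open>(\<alpha> * r)\<^sup>2\<close>, so only a rational identity
  remains.\<close>

lemma extremal_attains_bound:
  fixes r :: real
  assumes \<alpha>: "0 \<le> \<alpha>" "\<alpha> \<le> 1" and r: "0 < r" "r < 1"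
  shows "bohr_sum_tail (extremal_coeff \<alpha>) r = tail_bound \<alpha> r"
    and "bohr_sum_norm (extremal_coeff \<alpha>) r = norm_bound \<alpha> r"
proof -
  have cc: "convolution_contraction (\<lambda>n. extremal_coeff \<alpha> (Suc n))"
    by (rule bounded_class_convolution_contraction[OF extremal_bounded_class extremal_has_coeffs]) (rule \<alpha>)+
  have "\<alpha> * r \<le> 1 * r"
    using \<alpha> r by (intro mult_right_mono) auto
  then have \<alpha>r: "0 \<le> \<alpha> * r" "\<alpha> * r < 1"
    using \<alpha> r by (simp, linarith)
  then have \<alpha>r2: "(\<alpha> * r)\<^sup>2 < 1"
    by (simp add: abs_square_less_1)
  have \<alpha>2: "\<alpha>\<^sup>2 \<le> 1"
    using \<alpha> by (simp add: abs_square_le_1)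
  have coeff: "norm (extremal_coeff \<alpha> (Suc (Suc k))) = (1 - \<alpha>\<^sup>2) * \<alpha> ^ k" for k
  proof -
    have "extremal_coeff \<alpha> (Suc (Suc k)) = of_real (- ((1 - \<alpha>\<^sup>2) * \<alpha> ^ k))"
      by (simp add: extremal_coeff_def)
    then show ?thesis
      using \<alpha> \<alpha>2 by (simp only: norm_of_real) (simp add: abs_mult)
  qed
  have "(\<lambda>k. (1 - \<alpha>\<^sup>2) * r * (\<alpha> * r) ^ k) sums ((1 - \<alpha>\<^sup>2) * r * (1 / (1 - \<alpha> * r)))"
    by (intro sums_mult geometric_sums) (use \<alpha>r in simp)
  then have M1: "(\<Sum>k. norm (extremal_coeff \<alpha> (Suc (Suc k))) * r ^ Suc k) = (1 - \<alpha>\<^sup>2) * r / (1 - \<alpha> * r)"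
    unfolding coeff by (simp add: sums_iff power_mult_distrib mult_ac)
  have "(\<lambda>k. ((1 - \<alpha>\<^sup>2) * r)\<^sup>2 * ((\<alpha> * r)\<^sup>2) ^ k) sums (((1 - \<alpha>\<^sup>2) * r)\<^sup>2 * (1 / (1 - (\<alpha> * r)\<^sup>2)))"
    by (intro sums_mult geometric_sums) (use \<alpha>r2 in simp)
  also have "(\<lambda>k. ((1 - \<alpha>\<^sup>2) * r)\<^sup>2 * ((\<alpha> * r)\<^sup>2) ^ k) = (\<lambda>k. ((1 - \<alpha>\<^sup>2) * \<alpha> ^ k)\<^sup>2 * r ^ (2 * Suc k))"
    by (simp add: fun_eq_iff power_mult_distrib power_mult power_add power2_eq_square mult_ac)
  finally have M2: "(\<Sum>k. (norm (extremal_coeff \<alpha> (Suc (Suc k))))\<^sup>2 * r ^ (2 * Suc k)) =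
                    ((1 - \<alpha>\<^sup>2) * r)\<^sup>2 / (1 - (\<alpha> * r)\<^sup>2)"
    unfolding coeff by (simp add: sums_iff)
  have U: "r * ((1 - \<alpha>\<^sup>2) * r / (1 - \<alpha> * r) + (1 / (1 + \<alpha>) + r / (1 - r)) * (((1 - \<alpha>\<^sup>2) * r)\<^sup>2 / (1 - (\<alpha> * r)\<^sup>2)))
           = (1 - \<alpha>\<^sup>2) * r\<^sup>2 / (1 - r)"
  proof -
    define u v w where "u = 1 / (1 - \<alpha> * r)" and "v = 1 / (1 - r)" and "w = 1 / (1 + \<alpha>)"
    define t where "t = 1 / (1 + \<alpha> * r)"
    have eqs: "(1 - \<alpha> * r) * u = 1" "(1 - r) * v = 1" "(1 + \<alpha>) * w = 1" "(1 + \<alpha> * r) * t = 1"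
      using \<alpha>r r \<alpha> add_pos_nonneg[OF zero_less_one \<alpha>r(1)]
      by (simp_all add: u_def v_def w_def t_def)
    have div: "x / (1 - \<alpha> * r) = x * u" "x / (1 - r) = x * v" "x / (1 + \<alpha>) = x * w"
      "x / (1 - (\<alpha> * r)\<^sup>2) = x * (u * t)" for x
      using square_diff_one_factored[of "\<alpha> * r"]
      by (simp_all add: u_def v_def w_def t_def power2_eq_square algebra_simps)
    \<comment> \<open>Over a common denominator the weight has numerator
      \<open>1 + \<alpha> * r\<close>, which cancels one factor of
      \<open>1 - (\<alpha> * r)\<^sup>2\<close>.\<close>
    have 1: "w + r * v = (1 + \<alpha> * r) * (w * v)"
      using eqs(2,3) by algebra
    have 2: "(1 - \<alpha>\<^sup>2) * w = 1 - \<alpha>"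
      using eqs(3) by algebra
    have "(w + r * v) * (((1 - \<alpha>\<^sup>2) * r)\<^sup>2 * (u * t)) =
          ((1 + \<alpha> * r) * t) * ((1 - \<alpha>\<^sup>2) * w) * (1 - \<alpha>\<^sup>2) * r\<^sup>2 * (u * v)"
      unfolding 1 power2_eq_square by (simp only: mult_ac)
    also have "\<dots> = (1 - \<alpha>\<^sup>2) * r * ((1 - \<alpha>) * r * (u * v))"
      unfolding 2 eqs(4) by (simp add: power2_eq_square)
    finally have "r * ((1 - \<alpha>\<^sup>2) * r * u + (w + r * v) * (((1 - \<alpha>\<^sup>2) * r)\<^sup>2 * (u * t))) =
                  (1 - \<alpha>\<^sup>2) * r\<^sup>2 * (u + (1 - \<alpha>) * r * (u * v))"
      by (simp only: power2_eq_square distrib_left mult_ac)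
    moreover have "u + (1 - \<alpha>) * r * (u * v) = v"
      using eqs(1,2) by algebra
    ultimately show ?thesis
      unfolding div by (simp only: mult_1)
  qed
  have n1: "norm (extremal_coeff \<alpha> 1) = \<alpha>"
    by (rule norm_extremal_coeff_1[OF \<alpha>(1)])
  show "bohr_sum_tail (extremal_coeff \<alpha>) r = tail_bound \<alpha> r"
    unfolding bohr_sums_via_shifted_coeffs(1)[OF cc less_imp_le[OF r(1)] r(2)] M1 M2 n1 U tail_bound_def ..
  show "bohr_sum_norm (extremal_coeff \<alpha>) r = norm_bound \<alpha> r"
    unfolding bohr_sums_via_shifted_coeffs(2)[OF cc less_imp_le[OF r(1)] r(2) r(1)] M1 M2 n1 U
      tail_bound_def norm_bound_def ..
qed

section \<open>The one-variable inequalities for (a)\<close>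

lemma tail_bound_le_1:
  assumes "0 \<le> \<alpha>" "\<alpha> \<le> 1" "0 \<le> r" "r \<le> 3 / 5"
  shows "tail_bound \<alpha> r \<le> 1"
proof -
  \<comment> \<open>The product is \<open>9 * (1 - r) - 10 * r\<^sup>2\<close>. Once r is replaced
    by 3/5, the gap to 1 is a perfect square vanishing at \<alpha> = 1/3.\<close>
  have "0 \<le> (3 - 5 * r) * (2 * r + 3)"
    using assms by simp
  then have "10 * r\<^sup>2 \<le> 9 * (1 - r)"
    by (simp add: power2_eq_square algebra_simps)
  then have "r\<^sup>2 / (1 - r) \<le> 9 / 10"
    using assms by (simp add: field_simps)
  then have "(1 - \<alpha>\<^sup>2) * (r\<^sup>2 / (1 - r)) \<le> (1 - \<alpha>\<^sup>2) * (9 / 10)"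
    using assms by (intro mult_left_mono) (auto simp: abs_square_le_1)
  then have "(1 - \<alpha>\<^sup>2) * r\<^sup>2 / (1 - r) \<le> (1 - \<alpha>\<^sup>2) * (9 / 10)"
    by (simp only: times_divide_eq_right)
  moreover have "\<alpha> * r \<le> \<alpha> * (3 / 5)"
    using assms by (intro mult_left_mono) auto
  ultimately have "tail_bound \<alpha> r \<le> \<alpha> * (3 / 5) + (1 - \<alpha>\<^sup>2) * (9 / 10)"
    unfolding tail_bound_def by linarith
  also have "\<dots> = 1 - (3 * \<alpha> - 1)\<^sup>2 / 10"
    by (simp add: power2_eq_square field_simps)
  finally show ?thesis
    by (smt (verit) zero_le_power2 divide_nonneg_pos)
qed

lemma tail_bound_gt_1:
  assumes "3 / 5 < r" "r < 1"
  shows "1 < tail_bound (1 / 3) r"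
proof -
  \<comment> \<open>The product equals
    \<open>9 * (1 - r) * (tail_bound (1 / 3) r - 1)\<close>.\<close>
  have "0 < (5 * r - 3) * (r + 3)"
    using assms by simp
  then have "9 * (1 - r) < 3 * r * (1 - r) + 8 * r\<^sup>2"
    by (simp add: power2_eq_square algebra_simps)
  then show ?thesis
    using assms by (simp add: tail_bound_def field_simps power2_eq_square)
qed

section \<open>The radius in terms of a quadratic\<close>

text \<open>The numerator of \<open>norm_bound \<alpha> r - 1\<close> over the denominator
  \<open>(1 + \<alpha>) * (1 - r)\<close>.\<close>

definition bohr_quadratic :: "real \<Rightarrow> real \<Rightarrow> real" where
  "bohr_quadratic \<alpha> r = (1 - 2 * \<alpha>\<^sup>2) * r\<^sup>2 + (1 + 2 * \<alpha> + 2 * \<alpha>\<^sup>2) * r - (1 + \<alpha>)"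

lemma norm_bound_le_1_iff:
  assumes "0 \<le> \<alpha>" "r < 1"
  shows "norm_bound \<alpha> r \<le> 1 \<longleftrightarrow> bohr_quadratic \<alpha> r \<le> 0"
proof -
  define v w where "v = 1 / (1 - r)" and "w = 1 / (1 + \<alpha>)"
  have eqs: "(1 - r) * v = 1" "(1 + \<alpha>) * w = 1"
    using assms by (simp_all add: v_def w_def)
  have div: "x / (1 - r) = x * v" "x / (1 + \<alpha>) = x * w" for x
    by (simp_all add: v_def w_def)
  define c where "c = (1 + \<alpha>) * (1 - r)"
  have "bohr_quadratic \<alpha> r = (norm_bound \<alpha> r - 1) * c"
    unfolding c_def bohr_quadratic_def norm_bound_def tail_bound_def div using eqs by algebra
  moreover have "0 < c"
    using assms by (simp add: c_def)
  ultimately show ?thesis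
    by (simp add: mult_le_0_iff)
qed

text \<open>One sign of the absolute value keeps \<open>radius \<alpha>\<close> below 1, the other
  controls the second root of the quadratic.\<close>

lemma radius_sqrt_gt:
  fixes \<alpha> :: real
  assumes "0 \<le> \<alpha>"
  shows "\<bar>1 - 2 * \<alpha>\<^sup>2\<bar> < sqrt (4 * \<alpha> ^ 4 + 8 * \<alpha> + 5)"
proof (rule real_less_rsqrt)
  have "(1 - 2 * \<alpha>\<^sup>2)\<^sup>2 = 4 * \<alpha> ^ 4 + 1 - 4 * \<alpha>\<^sup>2"
    by algebra
  then show "\<bar>1 - 2 * \<alpha>\<^sup>2\<bar>\<^sup>2 < 4 * \<alpha> ^ 4 + 8 * \<alpha> + 5"
    using assms zero_le_power2[of \<alpha>] unfolding power2_abs by linarith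
qed

lemma radius_less_1:
  assumes "0 \<le> \<alpha>"
  shows "radius \<alpha> < 1"
  using radius_sqrt_gt[OF assms] assms by (simp add: radius_def divide_less_eq add_pos_nonneg)

lemma radius_pos:
  assumes "0 \<le> \<alpha>"
  shows "0 < radius \<alpha>"
  using assms by (simp add: radius_def add_pos_nonneg)

text \<open>\<open>D\<^sup>2\<close> is the discriminant in r. Writing the roots as
  \<open>2 * (1 + \<alpha>) / (B + D)\<close> and \<open>2 * (1 + \<alpha>) / (B - D)\<close> gives
  a factorization that holds even where the leading coefficient vanishes; its second factor is
  positive on (0,1).\<close>

lemma bohr_quadratic_le_0_iff:
  assumes \<alpha>: "0 \<le> \<alpha>" and r: "0 < r" "r < 1"
  shows "bohr_quadratic \<alpha> r \<le> 0 \<longleftrightarrow> r \<le> radius \<alpha>"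
proof -
  define B where "B = 1 + 2 * \<alpha> + 2 * \<alpha>\<^sup>2"
  define D where "D = sqrt (4 * \<alpha> ^ 4 + 8 * \<alpha> + 5)"
  have D2: "D\<^sup>2 = 4 * \<alpha> ^ 4 + 8 * \<alpha> + 5"
    unfolding D_def using \<alpha> by (intro real_sqrt_pow2) auto
  have BD: "0 < B + D"
    using \<alpha> by (simp add: B_def D_def add_pos_nonneg)
  have "4 * (1 + \<alpha>) * bohr_quadratic \<alpha> r = (r * (B + D) - 2 * (1 + \<alpha>)) * (2 * (1 + \<alpha>) - r * (B - D))"
    unfolding bohr_quadratic_def B_def using D2 by algebra
  moreover have "0 < 2 * (1 + \<alpha>) - r * (B - D)"
  proof -
    have "B - D < 2 * (1 + \<alpha>)"
      using radius_sqrt_gt[OF \<alpha>] by (simp add: B_def D_def)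
    from mult_strict_left_mono[OF this r(1)] have "r * (B - D) < r * (2 * (1 + \<alpha>))" .
    also have "\<dots> \<le> 1 * (2 * (1 + \<alpha>))"
      using r \<alpha> by (intro mult_right_mono) auto
    finally show ?thesis by simp
  qed
  ultimately have "4 * (1 + \<alpha>) * bohr_quadratic \<alpha> r \<le> 0 \<longleftrightarrow> r * (B + D) \<le> 2 * (1 + \<alpha>)"
    by (simp add: mult_le_0_iff)
  moreover have "4 * (1 + \<alpha>) * bohr_quadratic \<alpha> r \<le> 0 \<longleftrightarrow> bohr_quadratic \<alpha> r \<le> 0"
    using \<alpha> by (simp add: mult_le_0_iff)
  moreover have "r \<le> radius \<alpha> \<longleftrightarrow> r * (B + D) \<le> 2 * (1 + \<alpha>)"
    unfolding radius_def B_def[symmetric] D_def[symmetric] using BD by (simp add: pos_le_divide_eq)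
  ultimately show ?thesis
    by simp
qed

lemma radius_1: "radius 1 = (5 - sqrt 17) / 2"
proof -
  have "5 + sqrt 17 > 0"
    by (simp add: add_pos_nonneg)
  then have "4 / (5 + sqrt 17) = (5 - sqrt 17) / 2"
    by (simp add: divide_eq_eq) (simp add: algebra_simps)
  then show ?thesis
    by (simp add: radius_def)
qed

text \<open>For fixed r in (0,1) the quadratic is convex in \<alpha>, so it lies below its chord
  over [0,1]; only \<alpha> = 0 and \<alpha> = 1 need checking.\<close>

lemma radius_1_le_radius:
  assumes \<alpha>: "0 \<le> \<alpha>" "\<alpha> \<le> 1"
  shows "radius 1 \<le> radius \<alpha>"
proof -
  define r where "r = radius 1"
  have r: "0 < r" "r < 1"
    by (simp_all add: r_def radius_pos radius_less_1)
  have Q1: "bohr_quadratic 1 r \<le> 0"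
    using bohr_quadratic_le_0_iff[of 1 r] r by (simp add: r_def)
  then have "r * (5 - r) \<le> 2"
    by (simp add: bohr_quadratic_def power2_eq_square algebra_simps)
  moreover have "r * 4 \<le> r * (5 - r)"
    using r by (intro mult_left_mono) auto
  ultimately have "r \<le> 1 / 2"
    by simp
  moreover from this have "r * r \<le> (1 / 2) * (1 / 2)"
    using r by (intro mult_mono) auto
  ultimately have Q0: "bohr_quadratic 0 r \<le> 0"
    by (simp add: bohr_quadratic_def power2_eq_square)
  have "bohr_quadratic \<alpha> r =
          (1 - \<alpha>) * bohr_quadratic 0 r + \<alpha> * bohr_quadratic 1 r - 2 * r * (1 - r) * (\<alpha> * (1 - \<alpha>))"
    by (simp add: bohr_quadratic_def power2_eq_square algebra_simps)
  moreover have "(1 - \<alpha>) * bohr_quadratic 0 r \<le> 0" "\<alpha> * bohr_quadratic 1 r \<le> 0"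
    using Q0 Q1 \<alpha> by (simp_all add: mult_le_0_iff)
  moreover have "0 \<le> 2 * r * (1 - r) * (\<alpha> * (1 - \<alpha>))"
    using r \<alpha> by simp
  ultimately have "bohr_quadratic \<alpha> r \<le> 0"
    by linarith
  then show ?thesis
    using bohr_quadratic_le_0_iff[OF \<alpha>(1) r] by (simp add: r_def)
qed

lemma bohr_sum_norm_le_1:
  assumes "f \<in> \<B>" "has_coeffs f a" "0 < r" "r \<le> radius (norm (a 1))"
  shows "bohr_sum_norm a r \<le> 1"
proof -
  have r: "r < 1"
    using assms radius_less_1[of "norm (a 1)"] by simp
  then have "norm_bound (norm (a 1)) r \<le> 1"
    using assms by (simp add: norm_bound_le_1_iff bohr_quadratic_le_0_iff)
  with bohr_sum_le_bound(2)[OF assms(1,2) _ r] assms(3) show ?thesis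
    by simp
qed

lemma extremal_bohr_sum_norm_gt_1:
  assumes "0 \<le> \<alpha>" "\<alpha> \<le> 1" "radius \<alpha> < r" "r < 1"
  shows "0 < r" "\<not> bohr_sum_norm (extremal_coeff \<alpha>) r \<le> 1"
proof -
  show "0 < r"
    using radius_pos[OF assms(1)] assms(3) by linarith
  then show "\<not> bohr_sum_norm (extremal_coeff \<alpha>) r \<le> 1"
    using assms by (simp add: extremal_attains_bound norm_bound_le_1_iff bohr_quadratic_le_0_iff)
qed

theorem theorem3:
  shows
   "((\<forall>f a. f \<in> \<B> \<and> f 0 = 0 \<and> has_coeffs f a \<longrightarrow>
        (\<forall>r. 0 \<le> r \<and> r \<le> 3 / 5 \<longrightarrow> bohr_sum_tail a r \<le> 1)) \<and>
     (\<forall>R. 3 / 5 < R \<and> R < 1 \<longrightarrow>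
        (\<exists>f a r. f \<in> \<B> \<and> f 0 = 0 \<and> has_coeffs f a \<and>
           0 \<le> r \<and> r \<le> R \<and> \<not> bohr_sum_tail a r \<le> 1))) \<and>
    ((\<forall>f a. f \<in> \<B> \<and> f 0 = 0 \<and> has_coeffs f a \<longrightarrow>
        (\<forall>r. 0 < r \<and> r \<le> (5 - sqrt 17) / 2 \<longrightarrow> bohr_sum_norm a r \<le> 1)) \<and>
     (\<forall>R. (5 - sqrt 17) / 2 < R \<and> R < 1 \<longrightarrow>
        (\<exists>f a r. f \<in> \<B> \<and> f 0 = 0 \<and> has_coeffs f a \<and>
           0 < r \<and> r \<le> R \<and> \<not> bohr_sum_norm a r \<le> 1))) \<and>
    ((\<forall>f a. f \<in> \<B> \<and> f 0 = 0 \<and> has_coeffs f a \<longrightarrow>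
        (\<forall>r. 0 < r \<and> r \<le> radius (norm (a 1)) \<longrightarrow> bohr_sum_norm a r \<le> 1)) \<and>
     (\<forall>\<alpha> R. 0 \<le> \<alpha> \<and> \<alpha> < 1 \<and> radius \<alpha> < R \<and> R < 1 \<longrightarrow>
        (\<exists>f a r. f \<in> \<B> \<and> f 0 = 0 \<and> has_coeffs f a \<and> norm (a 1) = \<alpha> \<and>
           0 < r \<and> r \<le> R \<and> \<not> bohr_sum_norm a r \<le> 1)))"
proof (intro conjI allI impI; (elim conjE)?)
  fix f a and r :: real
  assume f: "f \<in> \<B>" "has_coeffs f a" and r: "0 \<le> r" "r \<le> 3 / 5"
  have "bohr_sum_tail a r \<le> tail_bound (norm (a 1)) r"
    by (rule bohr_sum_le_bound(1)[OF f]) (use r in auto)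
  also have "\<dots> \<le> 1"
    using norm_first_coeff_le_1[OF f] r by (intro tail_bound_le_1) auto
  finally show "bohr_sum_tail a r \<le> 1" .
next
  fix R :: real
  assume R: "3 / 5 < R" "R < 1"
  \<comment> \<open>The inequality already fails at r = R, here and in the other sharpness
    claims.\<close>
  have "\<not> bohr_sum_tail (extremal_coeff (1 / 3)) R \<le> 1"
    using tail_bound_gt_1[OF R] R by (simp add: extremal_attains_bound)
  then show "\<exists>f a r. f \<in> \<B> \<and> f 0 = 0 \<and> has_coeffs f a \<and> 0 \<le> r \<and> r \<le> R \<and> \<not> bohr_sum_tail a r \<le> 1"
    using R
    by (intro exI[of _ "extremal (1 / 3)"] exI[of _ "extremal_coeff (1 / 3)"] exI[of _ R] conjI
          extremal_bounded_class extremal_has_coeffs)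
       (simp_all add: extremal_def)
next
  fix f a and r :: real
  assume f: "f \<in> \<B>" "has_coeffs f a" and r: "0 < r" "r \<le> (5 - sqrt 17) / 2"
  \<comment> \<open>The radius in (b) is the minimum of \<open>radius\<close> over [0,1], taken at
    1.\<close>
  have "r \<le> radius (norm (a 1))"
    using radius_1_le_radius[OF norm_ge_zero norm_first_coeff_le_1[OF f]] r by (simp add: radius_1)
  with f r show "bohr_sum_norm a r \<le> 1"
    by (intro bohr_sum_norm_le_1)
next
  fix R :: real
  assume R: "(5 - sqrt 17) / 2 < R" "R < 1"
  from extremal_bohr_sum_norm_gt_1[of 1 R] R
  have "0 < R" "\<not> bohr_sum_norm (extremal_coeff 1) R \<le> 1"
    by (simp_all add: radius_1)
  then show "\<exists>f a r. f \<in> \<B> \<and> f 0 = 0 \<and> has_coeffs f a \<and> 0 < r \<and> r \<le> R \<and> \<not> bohr_sum_norm a r \<le> 1"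
    by (intro exI[of _ "extremal 1"] exI[of _ "extremal_coeff 1"] exI[of _ R] conjI
          extremal_bounded_class extremal_has_coeffs)
       (simp_all add: extremal_def)
next
  fix f a and r :: real
  assume "f \<in> \<B>" "has_coeffs f a" "0 < r" "r \<le> radius (norm (a 1))"
  then show "bohr_sum_norm a r \<le> 1"
    by (rule bohr_sum_norm_le_1)
next
  fix \<alpha> R :: real
  assume \<alpha>: "0 \<le> \<alpha>" "\<alpha> < 1" and R: "radius \<alpha> < R" "R < 1"
  from extremal_bohr_sum_norm_gt_1[of \<alpha> R] \<alpha> R
  have "0 < R" "\<not> bohr_sum_norm (extremal_coeff \<alpha>) R \<le> 1"
    by simp_all
  then show "\<exists>f a r. f \<in> \<B> \<and> f 0 = 0 \<and> has_coeffs f a \<and> norm (a 1) = \<alpha> \<and>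
           0 < r \<and> r \<le> R \<and> \<not> bohr_sum_norm a r \<le> 1"
    using \<alpha>
    by (intro exI[of _ "extremal \<alpha>"] exI[of _ "extremal_coeff \<alpha>"] exI[of _ R] conjI
          extremal_bounded_class extremal_has_coeffs norm_extremal_coeff_1)
       (simp_all add: extremal_def)
qed

end
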